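(* Let $A\in\mathbb{C}^{n\times n}$ be a sparse non-Hermitian positive definite matrix, and let $H=\frac12(A+A^* )$ and $S=\frac12(A-A^* )$ be its Hermitian and skew-Hermitian parts. Let $\alpha>0$, $\omega\in[0,2)$, and put $$M(\alpha)=(\alpha I+S)^{-1}(\alpha I-H)(\alpha I+H)^{-1}(\alpha I-S),$$ $$T(\alpha,\omega)=(\alpha I+S)^{-1}(\alpha I+H)^{-1}\bigl(\alpha^2I+HS-(1-\omega)\alpha A\bigr).$$ Let $\lambda_k$ ($k=1,\ldots,n$) be the eigenvalues of $M(\alpha)$ and write $\lambda_k=a_k+b_k i$ with $a_k,b_k\in\mathbb{R}$, $i=\sqrt{-1}$. (i) If $|\lambda_k|^2\le a_k$ for all $k$, then $$\rho(M(\alpha))\le\rho(T(\alpha,\omega))<1.$$ (ii) If $a_k<|\lambda_k|^2$ and $0<\omega<\dfrac{4a_k^2-4a_k+4b_k^2}{(1-a_k)^2+b_k^2}$ for all $k$, then $$\rho(T(\alpha,\omega))<\rho(M(\alpha))<1.$$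
   Context: $\rho(X)$ denotes the spectral radius of $X$, $X^*$ the conjugate transpose, $I$ the identity matrix. A (possibly non-Hermitian) matrix $X\in\mathbb{C}^{n\times n}$ is called positive definite if its Hermitian part $\frac12(X+X^* )$ is Hermitian positive definite. *)

theory Defs
  imports
    "Jordan_Normal_Form.Schur_Decomposition"
    "Jordan_Normal_Form.Gauss_Jordan_Elimination"
    "Jordan_Normal_Form.Spectral_Radius"
begin

definition mat_inv :: "complex mat \<Rightarrow> complex mat" where
  "mat_inv X = the (mat_inverse X)"

text \<open>For an invertible matrix this is indeed the inverse; it is only
  meaningful in that case.\<close>

lemma mat_inv_eqI:
  assumes X: "X \<in> carrier_mat n n" and Y: "Y \<in> carrier_mat n n"
    and XY: "X * Y = 1\<^sub>m n" and YX: "Y * X = 1\<^sub>m n"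
  shows "mat_inv X = Y"
proof (cases "mat_inverse X")
  case None
  have "X \<in> Units (ring_mat TYPE(complex) n ())"
    using X Y XY YX unfolding Units_def ring_mat_def by auto
  with mat_inverse(1)[OF X None, where b = "()"] show ?thesis by blast
next
  case (Some B)
  from mat_inverse(2)[OF X Some]
  have B: "B * X = 1\<^sub>m n" "B \<in> carrier_mat n n" by auto
  have "B = B * (X * Y)" using XY B(2) by simp
  also have "\<dots> = (B * X) * Y" using assoc_mult_mat[OF B(2) X Y] by simp
  finally show ?thesis using B(1) Y Some by (simp add: mat_inv_def)
qed

definition herm_part :: "complex mat \<Rightarrow> complex mat" where
  "herm_part X = (1 / 2) \<cdot>\<^sub>m (X + mat_adjoint X)"

definition skew_part :: "complex mat \<Rightarrow> complex mat" where
  "skew_part X = (1 / 2) \<cdot>\<^sub>m (X - mat_adjoint X)"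

definition hermitian_mat :: "complex mat \<Rightarrow> bool" where
  "hermitian_mat X \<longleftrightarrow> square_mat X \<and> mat_adjoint X = X"

text \<open>The order on \<^typ>\<open>complex\<close> is that of \<^theory>\<open>HOL-Library.Complex_Order\<close>:
  \<open>0 < z\<close> means that \<open>z\<close> is real and positive.  The number below is \<open>v\<^sup>* X v\<close>,
  as \<open>\<bullet>c\<close> conjugates its second argument.\<close>

definition hermitian_pos_def :: "complex mat \<Rightarrow> bool" where
  "hermitian_pos_def X \<longleftrightarrow> hermitian_mat X \<and>
     (\<forall>v \<in> carrier_vec (dim_row X). v \<noteq> 0\<^sub>v (dim_row X) \<longrightarrow> 0 < (X *\<^sub>v v) \<bullet>c v)"

definition pos_def :: "complex mat \<Rightarrow> bool" where
  "pos_def X \<longleftrightarrow> square_mat X \<and> hermitian_pos_def (herm_part X)"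

definition M_mat :: "complex mat \<Rightarrow> real \<Rightarrow> complex mat" where
  "M_mat A \<alpha> =
    (let H = herm_part A; S = skew_part A; aI = complex_of_real \<alpha> \<cdot>\<^sub>m 1\<^sub>m (dim_row A)
     in mat_inv (aI + S) * (aI - H) * mat_inv (aI + H) * (aI - S))"

definition T_mat :: "complex mat \<Rightarrow> real \<Rightarrow> real \<Rightarrow> complex mat" where
  "T_mat A \<alpha> \<omega> =
    (let H = herm_part A; S = skew_part A; I = 1\<^sub>m (dim_row A);
         aI = complex_of_real \<alpha> \<cdot>\<^sub>m I
     in mat_inv (aI + S) * mat_inv (aI + H) *
        (complex_of_real (\<alpha>\<^sup>2) \<cdot>\<^sub>m I + H * S - complex_of_real ((1 - \<omega>) * \<alpha>) \<cdot>\<^sub>m A))"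

text \<open>\<open>l 1, \<dots>, l n\<close> are the eigenvalues of the \<open>n \<times> n\<close> matrix \<open>X\<close>, listed with
  algebraic multiplicity.\<close>

definition eigenvalues_of :: "nat \<Rightarrow> complex mat \<Rightarrow> (nat \<Rightarrow> complex) \<Rightarrow> bool" where
  "eigenvalues_of n X l \<longleftrightarrow> char_poly X = (\<Prod>k = 1..n. [:- l k, 1:])"

end

theory Submission
  imports Defs
begin

text \<open>
  Write \<open>\<theta> = \<omega> / 2\<close>, \<open>P = \<alpha>I + S\<close> and \<open>Q = \<alpha>I + H\<close>.  Since \<open>QP = \<alpha>\<^sup>2I + HS + \<alpha>A\<close> and
  \<open>(\<alpha>I - H)(\<alpha>I - S) = \<alpha>\<^sup>2I + HS - \<alpha>A\<close>, the third factor of \<open>T\<close> is the combination of these two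
  products with the weights \<open>\<theta>\<close> and \<open>1 - \<theta>\<close>.  Moving \<open>Q\<^sup>-\<^sup>1\<close> past \<open>\<alpha>I - H\<close>, with which it
  commutes, turns this into \<open>T = (1 - \<theta>)M + \<theta>I\<close> (lemma \<open>T_mat_eq_relaxed_M_mat\<close>).  The
  eigenvalues of \<open>T\<close> are therefore the points \<open>(1 - \<theta>)\<nu> + \<theta>\<close>, where \<open>\<nu>\<close> runs through the
  eigenvalues of \<open>M\<close>: each \<open>\<nu>\<close> is moved along the segment from \<open>\<nu>\<close> to \<open>1\<close>.

  All eigenvalues of \<open>M\<close> lie in the open unit disc (lemma \<open>M_mat_eigenvalue_norm_less_1\<close>).  The
  reason is the identity
  \<open>\<parallel>(\<alpha>I + X)v\<parallel>\<^sup>2 - \<parallel>(\<alpha>I - X)v\<parallel>\<^sup>2 = 4\<alpha> Re \<langle>Xv, v\<rangle>\<close>: for \<open>X = S\<close> the right-hand side is zero, so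
  the Cayley transform of \<open>S\<close> preserves norms, and for \<open>X = H\<close> it is positive, so the Cayley
  transform of \<open>H\<close> shortens every nonzero vector.

  It remains to look at a single number.  From
  \<open>\<bar>(1 - \<theta>)\<nu> + \<theta>\<bar>\<^sup>2 - \<bar>\<nu>\<bar>\<^sup>2 = 2\<theta>(Re \<nu> - \<bar>\<nu>\<bar>\<^sup>2) + \<theta>\<^sup>2\<bar>1 - \<nu>\<bar>\<^sup>2\<close>
  one reads off that the modulus does not decrease if \<open>\<bar>\<nu>\<bar>\<^sup>2 \<le> Re \<nu>\<close>, and that it decreases
  strictly if \<open>0 < \<theta> < 2(\<bar>\<nu>\<bar>\<^sup>2 - Re \<nu>) / \<bar>1 - \<nu>\<bar>\<^sup>2\<close>, which is the bound on \<open>\<omega>\<close> in the second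
  part.  As the spectral radii are attained, the radii are compared at an eigenvalue of largest
  modulus: one of \<open>M\<close> for the first part, and one of \<open>T\<close> for the second.
\<close>

section \<open>Quadratic forms and shifted matrices\<close>

lemma Re_cscalar_prod:
  assumes "v \<in> carrier_vec n" "w \<in> carrier_vec n"
  shows "Re (v \<bullet>c w) = (\<Sum>i<n. Re (v $ i * cnj (w $ i)))"
  using assms by (simp add: scalar_prod_def lessThan_atLeast0)

lemma Re_cscalar_prod_self_pos_iff:
  fixes v :: "complex vec"
  assumes "v \<in> carrier_vec n"
  shows "0 < Re (v \<bullet>c v) \<longleftrightarrow> v \<noteq> 0\<^sub>v n"
  using conjugate_square_greater_0_vec[OF assms] conjugate_square_ge_0_vec[of v]
  by (auto simp: less_complex_def less_eq_complex_def)

lemma cscalar_prod_mat_adjoint: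
  fixes X :: "complex mat"
  assumes X: "X \<in> carrier_mat n n" and v: "v \<in> carrier_vec n"
  shows "(mat_adjoint X *\<^sub>v v) \<bullet>c v = cnj ((X *\<^sub>v v) \<bullet>c v)"
proof -
  have "(mat_adjoint X *\<^sub>v v) \<bullet>c v = (\<Sum>i<n. (\<Sum>j<n. cnj (X $$ (j, i)) * v $ j) * cnj (v $ i))"
    using X v by (auto simp: scalar_prod_def mat_adjoint_def lessThan_atLeast0 mat_of_rows_def
        intro!: sum.cong)
  also have "\<dots> = (\<Sum>j<n. \<Sum>i<n. cnj (X $$ (j, i)) * v $ j * cnj (v $ i))"
    by (simp add: sum_distrib_right) (rule sum.swap)
  also have "\<dots> = cnj ((X *\<^sub>v v) \<bullet>c v)"
    using X v by (auto simp: scalar_prod_def lessThan_atLeast0 sum_distrib_right sum_distrib_left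
        mult_ac intro!: sum.cong)
  finally show ?thesis .
qed

lemma mat_adjoint_carrier:
  "X \<in> carrier_mat n m \<Longrightarrow> mat_adjoint X \<in> carrier_mat m n"
  by (auto simp: mat_adjoint_def)

lemma herm_part_carrier:
  "A \<in> carrier_mat n n \<Longrightarrow> herm_part A \<in> carrier_mat n n"
  by (auto simp: herm_part_def dest: mat_adjoint_carrier)

lemma skew_part_carrier:
  "A \<in> carrier_mat n n \<Longrightarrow> skew_part A \<in> carrier_mat n n"
  by (auto simp: skew_part_def minus_carrier_mat dest: mat_adjoint_carrier)

lemma herm_part_plus_skew_part:
  assumes "A \<in> carrier_mat n n"
  shows "herm_part A + skew_part A = A"
  using assms mat_adjoint_carrier[OF assms]
  by (intro eq_matI) (auto simp: herm_part_def skew_part_def field_simps)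

text \<open>The form of \<open>A\<^sup>*\<close> is the complex conjugate of that of \<open>A\<close>, so their difference is purely
  imaginary.\<close>

lemma Re_skew_part_form:
  assumes A: "A \<in> carrier_mat n n" and v: "v \<in> carrier_vec n"
  shows "Re ((skew_part A *\<^sub>v v) \<bullet>c v) = 0"
proof -
  let ?B = "mat_adjoint A"
  note B = mat_adjoint_carrier[OF A]
  have "skew_part A *\<^sub>v v = (1 / 2) \<cdot>\<^sub>v (A *\<^sub>v v - ?B *\<^sub>v v)"
    unfolding skew_part_def minus_mult_distrib_mat_vec[OF A B v, symmetric]
    using A B v by (intro eq_vecI) (auto simp: row_smult)
  then have form: "(skew_part A *\<^sub>v v) \<bullet>c v = (1 / 2) * ((A *\<^sub>v v) \<bullet>c v - (?B *\<^sub>v v) \<bullet>c v)"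
    using A B v by (simp add: minus_scalar_prod_distrib[of _ n])
  show ?thesis
    unfolding form cscalar_prod_mat_adjoint[OF A v] by simp
qed

lemma pos_def_herm_part_form_pos:
  assumes A: "A \<in> carrier_mat n n" and "pos_def A" and "v \<in> carrier_vec n" "v \<noteq> 0\<^sub>v n"
  shows "0 < Re ((herm_part A *\<^sub>v v) \<bullet>c v)"
  using assms herm_part_carrier[OF A]
  by (auto simp: pos_def_def hermitian_pos_def_def less_complex_def)

lemma scalar_mat_mult:
  fixes X :: "complex mat"
  assumes X: "X \<in> carrier_mat n n"
  shows "(c \<cdot>\<^sub>m 1\<^sub>m n) * X = c \<cdot>\<^sub>m X" "X * (c \<cdot>\<^sub>m 1\<^sub>m n) = c \<cdot>\<^sub>m X"
  using X by (simp_all add: mult_smult_assoc_mat[of _ n n _ n] mult_smult_distrib[of _ n n _ n])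

lemma scalar_plus_mat_mult_vec:
  fixes X :: "complex mat"
  assumes X: "X \<in> carrier_mat n n" and v: "v \<in> carrier_vec n"
  shows "(c \<cdot>\<^sub>m 1\<^sub>m n + X) *\<^sub>v v = c \<cdot>\<^sub>v v + X *\<^sub>v v"
  using X v by (subst add_mult_distrib_mat_vec[of _ n n]) (auto intro!: eq_vecI simp: row_smult)

lemma scalar_minus_mat_mult_vec:
  fixes X :: "complex mat"
  assumes X: "X \<in> carrier_mat n n" and v: "v \<in> carrier_vec n"
  shows "(c \<cdot>\<^sub>m 1\<^sub>m n - X) *\<^sub>v v = c \<cdot>\<^sub>v v - X *\<^sub>v v"
  using X v by (subst minus_mult_distrib_mat_vec[of _ n n]) (auto intro!: eq_vecI simp: row_smult)

text \<open>The parallelogram-type identity that decides whether the Cayley transform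
  \<open>(\<alpha>I - X)(\<alpha>I + X)\<^sup>-\<^sup>1\<close> shortens vectors or preserves their length.\<close>

lemma shifted_norm_gap:
  fixes X :: "complex mat" and \<alpha> :: real
  assumes X: "X \<in> carrier_mat n n" and v: "v \<in> carrier_vec n"
  defines "p \<equiv> (complex_of_real \<alpha> \<cdot>\<^sub>m 1\<^sub>m n + X) *\<^sub>v v"
    and "q \<equiv> (complex_of_real \<alpha> \<cdot>\<^sub>m 1\<^sub>m n - X) *\<^sub>v v"
  shows "Re (p \<bullet>c p) - Re (q \<bullet>c q) = 4 * \<alpha> * Re ((X *\<^sub>v v) \<bullet>c v)"
proof -
  define u where "u = X *\<^sub>v v"
  have u: "u \<in> carrier_vec n" using X v by (simp add: u_def)
  have p: "p = complex_of_real \<alpha> \<cdot>\<^sub>v v + u" and q: "q = complex_of_real \<alpha> \<cdot>\<^sub>v v - u"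
    unfolding p_def q_def u_def
    by (rule scalar_plus_mat_mult_vec[OF X v], rule scalar_minus_mat_mult_vec[OF X v])
  have pq: "p \<in> carrier_vec n" "q \<in> carrier_vec n" using u v by (auto simp: p q)
  show ?thesis
    unfolding u_def[symmetric] Re_cscalar_prod[OF pq(1) pq(1)] Re_cscalar_prod[OF pq(2) pq(2)]
      Re_cscalar_prod[OF u v] sum_subtractf[symmetric] sum_distrib_left
    using u v by (intro sum.cong) (auto simp: p q algebra_simps)
qed

text \<open>Here \<open>\<alpha> > 0\<close> makes \<open>Re \<langle>(\<alpha>I + X)v, v\<rangle>\<close> positive for \<open>v \<noteq> 0\<close>, which rules out a kernel.\<close>

lemma mat_inv_scalar_plus_accretive:
  fixes X :: "complex mat" and \<alpha> :: real
  assumes X: "X \<in> carrier_mat n n" and \<alpha>: "\<alpha> > 0"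
    and nonneg: "\<And>v. v \<in> carrier_vec n \<Longrightarrow> 0 \<le> Re ((X *\<^sub>v v) \<bullet>c v)"
  defines "Y \<equiv> complex_of_real \<alpha> \<cdot>\<^sub>m 1\<^sub>m n + X"
  shows "mat_inv Y \<in> carrier_mat n n" "Y * mat_inv Y = 1\<^sub>m n" "mat_inv Y * Y = 1\<^sub>m n"
proof -
  have Y: "Y \<in> carrier_mat n n" using X by (simp add: Y_def)
  have "v = 0\<^sub>v n" if v: "v \<in> carrier_vec n" and 0: "Y *\<^sub>v v = 0\<^sub>v n" for v
  proof (rule ccontr)
    assume "v \<noteq> 0\<^sub>v n"
    then have "0 < Re (v \<bullet>c v)" using v by (simp add: Re_cscalar_prod_self_pos_iff)
    then have "0 < \<alpha> * Re (v \<bullet>c v) + Re ((X *\<^sub>v v) \<bullet>c v)"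
      using \<alpha> nonneg[OF v] by (simp add: add_pos_nonneg)
    also have "\<dots> = Re ((Y *\<^sub>v v) \<bullet>c v)"
      unfolding Y_def scalar_plus_mat_mult_vec[OF X v]
      using X v by (simp add: add_scalar_prod_distrib[of _ n])
    finally show False using 0 v by simp
  qed
  then have "det Y \<noteq> 0" using det_0_iff_vec_prod_zero_field[OF Y] by blast
  from det_non_zero_imp_unit[OF Y this, of "()"]
  obtain B where B: "mat_inverse Y = Some B"
    using mat_inverse(1)[OF Y, of "()"] by (cases "mat_inverse Y") auto
  from mat_inverse(2)[OF Y B]
  show "mat_inv Y \<in> carrier_mat n n" "Y * mat_inv Y = 1\<^sub>m n" "mat_inv Y * Y = 1\<^sub>m n"
    by (auto simp: mat_inv_def B)
qed

section \<open>The iteration matrices\<close>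

text \<open>These hypotheses make \<open>\<alpha>I + H\<close> and \<open>\<alpha>I + S\<close> invertible, so that the inverses in the
  definitions of \<open>M\<close> and \<open>T\<close> have their usual meaning.\<close>

locale hss_splitting =
  fixes A :: "complex mat" and n :: nat and \<alpha> :: real
  assumes A: "A \<in> carrier_mat n n" and pd: "pos_def A" and \<alpha>: "\<alpha> > 0"
begin

abbreviation "H \<equiv> herm_part A"
abbreviation "S \<equiv> skew_part A"
abbreviation "aI \<equiv> complex_of_real \<alpha> \<cdot>\<^sub>m 1\<^sub>m n"
abbreviation "P \<equiv> aI + S"
abbreviation "Q \<equiv> aI + H"

lemmas H = herm_part_carrier[OF A]
lemmas S = skew_part_carrier[OF A]

lemma H_form_nonneg: "v \<in> carrier_vec n \<Longrightarrow> 0 \<le> Re ((H *\<^sub>v v) \<bullet>c v)"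
  using pos_def_herm_part_form_pos[OF A pd, of v] H by (cases "v = 0\<^sub>v n") auto

lemmas mat_inv_Q = mat_inv_scalar_plus_accretive[OF H \<alpha> H_form_nonneg]

lemmas mat_inv_P = mat_inv_scalar_plus_accretive
  [OF S \<alpha> eq_refl[OF Re_skew_part_form[OF A, symmetric]]]

lemma carriers:
  "P \<in> carrier_mat n n" "Q \<in> carrier_mat n n" "aI - H \<in> carrier_mat n n"
  "aI - S \<in> carrier_mat n n" "mat_inv P \<in> carrier_mat n n" "mat_inv Q \<in> carrier_mat n n"
  using H S mat_inv_P(1) mat_inv_Q(1) by (auto simp: minus_carrier_mat)

lemma M_mat_eq: "M_mat A \<alpha> = mat_inv P * (aI - H) * mat_inv Q * (aI - S)"
  using A by (simp add: M_mat_def Let_def)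

lemma M_mat_carrier: "M_mat A \<alpha> \<in> carrier_mat n n"
  unfolding M_mat_eq using carriers by (meson mult_carrier_mat)

text \<open>For an eigenvector \<open>x\<close> of \<open>M\<close> put \<open>w = (\<alpha>I - S)x\<close> and \<open>z = (\<alpha>I + H)\<^sup>-\<^sup>1w\<close>.  Then
  \<open>\<nu>Px = (\<alpha>I - H)z\<close> is strictly shorter than \<open>Qz = w\<close>, while \<open>w\<close> has the length of \<open>Px\<close>.\<close>

lemma M_mat_eigenvalue_norm_less_1:
  assumes "eigenvalue (M_mat A \<alpha>) \<nu>"
  shows "cmod \<nu> < 1"
proof -
  from assms M_mat_carrier obtain x where x: "x \<in> carrier_vec n" and x0: "x \<noteq> 0\<^sub>v n"
    and Mx: "M_mat A \<alpha> *\<^sub>v x = \<nu> \<cdot>\<^sub>v x"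
    by (auto simp: eigenvalue_def eigenvector_def)
  define y where "y = P *\<^sub>v x"
  define w where "w = (aI - S) *\<^sub>v x"
  define z where "z = mat_inv Q *\<^sub>v w"
  define r where "r = (aI - H) *\<^sub>v z"
  have y: "y \<in> carrier_vec n" and w: "w \<in> carrier_vec n" and z: "z \<in> carrier_vec n"
    and r: "r \<in> carrier_vec n"
    using carriers x by (auto simp: y_def w_def z_def r_def)
  have "y \<noteq> 0\<^sub>v n"
  proof
    assume "y = 0\<^sub>v n"
    moreover have "mat_inv P *\<^sub>v y = x"
      unfolding y_def using carriers x mat_inv_P(3)
      by (metis assoc_mult_mat_vec one_mult_mat_vec)
    ultimately show False using x0 carriers(5) by auto
  qed
  then have y_pos: "0 < Re (y \<bullet>c y)" using y by (simp add: Re_cscalar_prod_self_pos_iff)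
  have wy: "Re (w \<bullet>c w) = Re (y \<bullet>c y)"
    using shifted_norm_gap[OF S x, of \<alpha>] Re_skew_part_form[OF A x] by (simp add: y_def w_def)
  then have "w \<noteq> 0\<^sub>v n" using y_pos Re_cscalar_prod_self_pos_iff[OF w] by simp
  have Qz: "Q *\<^sub>v z = w"
    unfolding z_def using carriers w mat_inv_Q(2) by (metis assoc_mult_mat_vec one_mult_mat_vec)
  with \<open>w \<noteq> 0\<^sub>v n\<close> have "z \<noteq> 0\<^sub>v n"
    using H by (auto simp: scalar_plus_mat_mult_vec)
  then have rw: "Re (r \<bullet>c r) < Re (w \<bullet>c w)"
    using shifted_norm_gap[OF H z, of \<alpha>] pos_def_herm_part_form_pos[OF A pd z] \<alpha>
    unfolding Qz r_def[symmetric] by (smt (verit) mult_pos_pos)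
  have "M_mat A \<alpha> *\<^sub>v x = mat_inv P *\<^sub>v r"
    unfolding M_mat_eq r_def z_def w_def using carriers x
    by (simp add: assoc_mult_mat_vec[of _ n n _ n] mult_carrier_mat[of _ n n _ n])
  then have "P *\<^sub>v (\<nu> \<cdot>\<^sub>v x) = P *\<^sub>v (mat_inv P *\<^sub>v r)" using Mx by simp
  also have "\<dots> = r" using carriers r mat_inv_P(2) by (metis assoc_mult_mat_vec one_mult_mat_vec)
  finally have "r = \<nu> \<cdot>\<^sub>v y" unfolding y_def by (simp add: mult_mat_vec[OF carriers(1) x])
  then have "r \<bullet>c r = (\<nu> * cnj \<nu>) * (y \<bullet>c y)"
    using y by (simp add: conjugate_smult_vec)
  then have "Re (r \<bullet>c r) = (cmod \<nu>)\<^sup>2 * Re (y \<bullet>c y)"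
    by (simp add: complex_norm_square[symmetric] del: of_real_power)
  with rw wy have "(cmod \<nu>)\<^sup>2 * Re (y \<bullet>c y) < 1 * Re (y \<bullet>c y)" by simp
  with y_pos have "(cmod \<nu>)\<^sup>2 < 1\<^sup>2" by simp
  then show ?thesis by (rule power2_less_imp_less) simp
qed

lemma QP_eq: "Q * P = complex_of_real (\<alpha>\<^sup>2) \<cdot>\<^sub>m 1\<^sub>m n + H * S + complex_of_real \<alpha> \<cdot>\<^sub>m A"
proof -
  have "Q * P = aI * aI + H * aI + (aI * S + H * S)"
    using H S by (simp add: add_mult_distrib_mat[of _ n n _ _ n] mult_add_distrib_mat[of _ n n _ n])
  also have "\<dots> = complex_of_real (\<alpha>\<^sup>2) \<cdot>\<^sub>m 1\<^sub>m n + H * S + complex_of_real \<alpha> \<cdot>\<^sub>m (H + S)"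
    using H S
    by (intro eq_matI) (auto simp: power2_eq_square algebra_simps scalar_mat_mult
        simp del: index_mult_mat(1))
  finally show ?thesis unfolding herm_part_plus_skew_part[OF A] .
qed

lemma shifted_difference_product_eq:
  "(aI - H) * (aI - S) = complex_of_real (\<alpha>\<^sup>2) \<cdot>\<^sub>m 1\<^sub>m n + H * S - complex_of_real \<alpha> \<cdot>\<^sub>m A"
proof -
  have "(aI - H) * (aI - S) = aI * aI - H * aI - (aI * S - H * S)"
    using H S by (simp add: minus_mult_distrib_mat[of _ n n _ _ n]
        mult_minus_distrib_mat[of _ n n _ n] minus_carrier_mat)
  also have "\<dots> = complex_of_real (\<alpha>\<^sup>2) \<cdot>\<^sub>m 1\<^sub>m n + H * S - complex_of_real \<alpha> \<cdot>\<^sub>m (H + S)"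
    using H S
    by (intro eq_matI) (auto simp: power2_eq_square algebra_simps scalar_mat_mult
        simp del: index_mult_mat(1))
  finally show ?thesis unfolding herm_part_plus_skew_part[OF A] .
qed

lemma mat_inv_Q_commute: "(aI - H) * mat_inv Q = mat_inv Q * (aI - H)"
proof -
  let ?R = "aI - H" and ?B = "mat_inv Q"
  have "Q * ?R = aI * aI + H * aI - (aI * H + H * H)"
    using H by (simp add: add_mult_distrib_mat[of _ n n _ _ n]
        mult_minus_distrib_mat[of _ n n _ n] minus_carrier_mat)
  also have "\<dots> = aI * aI + aI * H - (H * aI + H * H)"
    using H by (intro eq_matI) (auto simp: algebra_simps scalar_mat_mult
        simp del: index_mult_mat(1))
  also have "\<dots> = ?R * Q"
    using H by (simp add: minus_mult_distrib_mat[of _ n n _ _ n] mult_add_distrib_mat[of _ n n _ n])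
  finally have comm: "Q * ?R = ?R * Q" .
  have "?R * ?B = ?B * Q * (?R * ?B)"
    using carriers mat_inv_Q(3)
    by (simp add: mult_carrier_mat[of _ n n _ n] left_mult_one_mat[of _ n n])
  also have "\<dots> = ?B * (Q * ?R) * ?B"
    using carriers by (simp add: assoc_mult_mat[of _ n n _ n _ n] mult_carrier_mat[of _ n n _ n])
  also have "\<dots> = ?B * ?R * (Q * ?B)"
    unfolding comm
    using carriers by (simp add: assoc_mult_mat[of _ n n _ n _ n] mult_carrier_mat[of _ n n _ n])
  also have "\<dots> = ?B * ?R"
    using carriers mat_inv_Q(2)
    by (simp add: mult_carrier_mat[of _ n n _ n] right_mult_one_mat[of _ n n])
  finally show ?thesis .
qed

text \<open>The matrix \<open>\<alpha>A\<close> is half the difference of the products \<open>(\<alpha>I + H)(\<alpha>I + S)\<close> and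
  \<open>(\<alpha>I - H)(\<alpha>I - S)\<close>, so the summand \<open>\<omega>\<alpha>A\<close> of the third factor moves the second product towards
  the first by the fraction \<open>\<omega> / 2\<close>.\<close>

lemma T_mat_eq_relaxed_M_mat:
  "T_mat A \<alpha> \<omega> = complex_of_real (1 - \<omega> / 2) \<cdot>\<^sub>m M_mat A \<alpha> + complex_of_real (\<omega> / 2) \<cdot>\<^sub>m 1\<^sub>m n"
proof -
  let ?c = "complex_of_real (1 - \<omega> / 2)" and ?d = "complex_of_real (\<omega> / 2)"
  let ?N = "(aI - H) * (aI - S)" and ?B = "mat_inv P * mat_inv Q"
  have N: "?N \<in> carrier_mat n n" and K: "Q * P \<in> carrier_mat n n" and B: "?B \<in> carrier_mat n n"
    using carriers by (auto intro: mult_carrier_mat)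
  have third: "complex_of_real (\<alpha>\<^sup>2) \<cdot>\<^sub>m 1\<^sub>m n + H * S - complex_of_real ((1 - \<omega>) * \<alpha>) \<cdot>\<^sub>m A
      = ?c \<cdot>\<^sub>m ?N + ?d \<cdot>\<^sub>m (Q * P)"
    unfolding QP_eq shifted_difference_product_eq using A H S
    by (intro eq_matI) (auto simp: field_simps simp del: index_mult_mat(1))
  have "M_mat A \<alpha> = mat_inv P * ((aI - H) * mat_inv Q) * (aI - S)"
    unfolding M_mat_eq using carriers by (simp add: assoc_mult_mat[of _ n n _ n _ n])
  also have "\<dots> = ?B * ?N"
    unfolding mat_inv_Q_commute
    using carriers by (simp add: assoc_mult_mat[of _ n n _ n _ n] mult_carrier_mat[of _ n n _ n])
  finally have M: "M_mat A \<alpha> = ?B * ?N" .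
  have "?B * (Q * P) = mat_inv P * (mat_inv Q * Q) * P"
    using carriers by (simp add: assoc_mult_mat[of _ n n _ n _ n] mult_carrier_mat[of _ n n _ n])
  also have "\<dots> = 1\<^sub>m n"
    using carriers mat_inv_P(3) mat_inv_Q(3) by simp
  finally have one: "?B * (Q * P) = 1\<^sub>m n" .
  have "T_mat A \<alpha> \<omega> = ?B * (?c \<cdot>\<^sub>m ?N + ?d \<cdot>\<^sub>m (Q * P))"
    using A third by (simp add: T_mat_def Let_def)
  also have "\<dots> = ?c \<cdot>\<^sub>m (?B * ?N) + ?d \<cdot>\<^sub>m (?B * (Q * P))"
    using N K B by (simp add: mult_add_distrib_mat[of _ n n _ n] mult_smult_distrib[of _ n n])
  finally show ?thesis unfolding one M .
qed

end

section \<open>Spectra under relaxation\<close>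

lemma eigenvalue_affine:
  fixes X :: "complex mat"
  assumes X: "X \<in> carrier_mat n n" and ev: "eigenvalue X \<nu>"
  shows "eigenvalue (c \<cdot>\<^sub>m X + d \<cdot>\<^sub>m 1\<^sub>m n) (c * \<nu> + d)"
proof -
  from ev X obtain x where x: "x \<in> carrier_vec n" "x \<noteq> 0\<^sub>v n" "X *\<^sub>v x = \<nu> \<cdot>\<^sub>v x"
    by (auto simp: eigenvalue_def eigenvector_def)
  have "(c \<cdot>\<^sub>m X) *\<^sub>v x = c \<cdot>\<^sub>v (X *\<^sub>v x)" "(d \<cdot>\<^sub>m 1\<^sub>m n) *\<^sub>v x = d \<cdot>\<^sub>v x"
    using X x(1) by (auto intro!: eq_vecI simp: row_smult)
  then have "(c \<cdot>\<^sub>m X + d \<cdot>\<^sub>m 1\<^sub>m n) *\<^sub>v x = (c * \<nu> + d) \<cdot>\<^sub>v x"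
    using X x by (simp add: add_mult_distrib_mat_vec[of _ n n] smult_smult_assoc
        add_smult_distrib_vec)
  then show ?thesis using X x by (auto simp: eigenvalue_def eigenvector_def)
qed

lemma spectrum_affine:
  fixes X :: "complex mat"
  assumes X: "X \<in> carrier_mat n n" and c: "c \<noteq> 0"
  shows "spectrum (c \<cdot>\<^sub>m X + d \<cdot>\<^sub>m 1\<^sub>m n) = (\<lambda>\<nu>. c * \<nu> + d) ` spectrum X"
proof (intro equalityI subsetI)
  fix \<mu> assume "\<mu> \<in> spectrum (c \<cdot>\<^sub>m X + d \<cdot>\<^sub>m 1\<^sub>m n)"
  then have "eigenvalue (c \<cdot>\<^sub>m X + d \<cdot>\<^sub>m 1\<^sub>m n) \<mu>" by (simp add: spectrum_def)
  (* The inverse affine map takes the matrix back to X and \<mu> back to an eigenvalue of X. *)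
  from eigenvalue_affine[OF _ this, of n "1 / c" "- d / c"] X
  have "eigenvalue ((1 / c) \<cdot>\<^sub>m (c \<cdot>\<^sub>m X + d \<cdot>\<^sub>m 1\<^sub>m n) + (- d / c) \<cdot>\<^sub>m 1\<^sub>m n) ((\<mu> - d) / c)"
    by (simp add: diff_divide_distrib)
  also have "(1 / c) \<cdot>\<^sub>m (c \<cdot>\<^sub>m X + d \<cdot>\<^sub>m 1\<^sub>m n) + (- d / c) \<cdot>\<^sub>m 1\<^sub>m n = X"
    using X c by (intro eq_matI) (auto simp: field_simps)
  finally have "(\<mu> - d) / c \<in> spectrum X" by (simp add: spectrum_def)
  moreover have "\<mu> = c * ((\<mu> - d) / c) + d" using c by simp
  ultimately show "\<mu> \<in> (\<lambda>\<nu>. c * \<nu> + d) ` spectrum X" by blast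
qed (auto simp: spectrum_def intro: eigenvalue_affine[OF X])

lemma spectral_radius_attained:
  assumes "X \<in> carrier_mat n n" "n > 0"
  obtains \<nu> where "\<nu> \<in> spectrum X" "spectral_radius X = cmod \<nu>"
  using spectral_radius_mem_max(1)[OF assms] by auto

lemma norm_le_spectral_radius:
  assumes "X \<in> carrier_mat n n" "n > 0" "\<nu> \<in> spectrum X"
  shows "cmod \<nu> \<le> spectral_radius X"
  using spectral_radius_mem_max(2)[OF assms(1,2)] assms(3) by blast

lemma eigenvalues_of_spectrum:
  assumes "X \<in> carrier_mat n n" "eigenvalues_of n X l"
  shows "spectrum X = l ` {1..n}"
  using assms by (auto simp: spectrum_root_char_poly eigenvalues_of_def poly_prod)

section \<open>Moving a number towards one\<close>

lemma norm_sq_relaxed: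
  fixes \<nu> :: complex and t :: real
  shows "(cmod (complex_of_real (1 - t) * \<nu> + complex_of_real t))\<^sup>2
    = (cmod \<nu>)\<^sup>2 + 2 * t * (Re \<nu> - (cmod \<nu>)\<^sup>2) + t\<^sup>2 * (cmod (1 - \<nu>))\<^sup>2"
  unfolding cmod_power2 by (simp add: power2_eq_square algebra_simps)

lemma norm_relaxed_ge:
  fixes \<nu> :: complex and t :: real
  assumes "0 \<le> t" "(cmod \<nu>)\<^sup>2 \<le> Re \<nu>"
  shows "cmod \<nu> \<le> cmod (complex_of_real (1 - t) * \<nu> + complex_of_real t)"
proof (rule power2_le_imp_le)
  show "(cmod \<nu>)\<^sup>2 \<le> (cmod (complex_of_real (1 - t) * \<nu> + complex_of_real t))\<^sup>2"
    unfolding norm_sq_relaxed using assms by simp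
qed simp

lemma norm_relaxed_less:
  fixes \<nu> :: complex and t :: real
  assumes t: "0 < t" and less: "t * (cmod (1 - \<nu>))\<^sup>2 < 2 * ((cmod \<nu>)\<^sup>2 - Re \<nu>)"
  shows "cmod (complex_of_real (1 - t) * \<nu> + complex_of_real t) < cmod \<nu>"
proof (rule power2_less_imp_less)
  from mult_strict_left_mono[OF less t]
  show "(cmod (complex_of_real (1 - t) * \<nu> + complex_of_real t))\<^sup>2 < (cmod \<nu>)\<^sup>2"
    unfolding norm_sq_relaxed by (simp add: power2_eq_square algebra_simps)
qed simp

lemma norm_relaxed_less_1:
  fixes \<nu> :: complex and t :: real
  assumes "0 \<le> t" "t < 1" "cmod \<nu> < 1"
  shows "cmod (complex_of_real (1 - t) * \<nu> + complex_of_real t) < 1"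
proof -
  have "cmod (complex_of_real (1 - t) * \<nu> + complex_of_real t) \<le> (1 - t) * cmod \<nu> + t"
    using norm_triangle_ineq[of "complex_of_real (1 - t) * \<nu>" "complex_of_real t"] assms
    by (simp add: norm_mult del: of_real_diff)
  also have "\<dots> < (1 - t) * 1 + t" using assms by (intro add_strict_right_mono) simp
  finally show ?thesis by simp
qed

section \<open>Comparison of the spectral radii\<close>

theorem theorem2p5:
  fixes A :: "complex mat" and n :: nat and \<alpha> \<omega> :: real
    and l :: "nat \<Rightarrow> complex" and a b :: "nat \<Rightarrow> real"
  assumes "n \<ge> 1"
    and "A \<in> carrier_mat n n"
    and "\<not> hermitian_mat A"
    and "pos_def A"
    and "\<alpha> > 0"
    and "0 \<le> \<omega>" and "\<omega> < 2"
    and "eigenvalues_of n (M_mat A \<alpha>) l"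
    and "\<And>k. k \<in> {1..n} \<Longrightarrow> l k = complex_of_real (a k) + complex_of_real (b k) * \<i>"
  shows "((\<forall>k\<in>{1..n}. (cmod (l k))\<^sup>2 \<le> a k) \<longrightarrow>
            spectral_radius (M_mat A \<alpha>) \<le> spectral_radius (T_mat A \<alpha> \<omega>) \<and>
            spectral_radius (T_mat A \<alpha> \<omega>) < 1)
       \<and> ((\<forall>k\<in>{1..n}. a k < (cmod (l k))\<^sup>2 \<and> 0 < \<omega> \<and>
              \<omega> < (4 * (a k)\<^sup>2 - 4 * a k + 4 * (b k)\<^sup>2) / ((1 - a k)\<^sup>2 + (b k)\<^sup>2)) \<longrightarrow>
            spectral_radius (T_mat A \<alpha> \<omega>) < spectral_radius (M_mat A \<alpha>) \<and>
            spectral_radius (M_mat A \<alpha>) < 1)"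
proof -
  interpret hss_splitting A n \<alpha>
    using assms by unfold_locales
  let ?M = "M_mat A \<alpha>" and ?T = "T_mat A \<alpha> \<omega>"
  define f where "f \<nu> = complex_of_real (1 - \<omega> / 2) * \<nu> + complex_of_real (\<omega> / 2)" for \<nu>
  have n: "n > 0" using assms by simp
  note M = M_mat_carrier
  have T: "?T \<in> carrier_mat n n"
    unfolding T_mat_eq_relaxed_M_mat using M by simp
  have spec_M: "spectrum ?M = l ` {1..n}"
    by (rule eigenvalues_of_spectrum[OF M assms(8)])
  have "complex_of_real (1 - \<omega> / 2) \<noteq> 0"
    unfolding of_real_eq_0_iff using \<open>\<omega> < 2\<close> by simp
  then have spec_T: "spectrum ?T = f ` spectrum ?M"
    unfolding T_mat_eq_relaxed_M_mat f_def by (rule spectrum_affine[OF M])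
  have disc: "cmod \<nu> < 1" if "\<nu> \<in> spectrum ?M" for \<nu>
    using that M_mat_eigenvalue_norm_less_1 by (simp add: spectrum_def)
  have Re_l: "Re (l k) = a k" and Im_l: "Im (l k) = b k" if "k \<in> {1..n}" for k
    using assms(9)[OF that] by auto
  have "spectral_radius ?M \<le> spectral_radius ?T \<and> spectral_radius ?T < 1"
    if i: "\<forall>k\<in>{1..n}. (cmod (l k))\<^sup>2 \<le> a k"
  proof
    obtain \<nu> where \<nu>: "\<nu> \<in> spectrum ?M" "spectral_radius ?M = cmod \<nu>"
      using spectral_radius_attained[OF M n] .
    then have "cmod \<nu> \<le> cmod (f \<nu>)"
      unfolding f_def using i Re_l \<open>0 \<le> \<omega>\<close> by (intro norm_relaxed_ge) (auto simp: spec_M)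
    also have "\<dots> \<le> spectral_radius ?T"
      using \<nu>(1) by (intro norm_le_spectral_radius[OF T n]) (simp add: spec_T)
    finally show "spectral_radius ?M \<le> spectral_radius ?T" using \<nu>(2) by simp
  next
    obtain \<mu> where "\<mu> \<in> spectrum ?T" and \<mu>: "spectral_radius ?T = cmod \<mu>"
      using spectral_radius_attained[OF T n] .
    then obtain \<nu> where "\<nu> \<in> spectrum ?M" "\<mu> = f \<nu>" by (auto simp: spec_T)
    then show "spectral_radius ?T < 1"
      unfolding \<mu> using disc norm_relaxed_less_1[of "\<omega> / 2" \<nu>] \<open>0 \<le> \<omega>\<close> \<open>\<omega> < 2\<close>
      by (simp add: f_def)
  qed
  moreover have "spectral_radius ?T < spectral_radius ?M \<and> spectral_radius ?M < 1"
    if ii: "\<forall>k\<in>{1..n}. a k < (cmod (l k))\<^sup>2 \<and> 0 < \<omega> \<and>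
      \<omega> < (4 * (a k)\<^sup>2 - 4 * a k + 4 * (b k)\<^sup>2) / ((1 - a k)\<^sup>2 + (b k)\<^sup>2)"
  proof
    obtain \<mu> where "\<mu> \<in> spectrum ?T" and \<mu>: "spectral_radius ?T = cmod \<mu>"
      using spectral_radius_attained[OF T n] .
    then obtain k where k: "k \<in> {1..n}" and \<mu>_eq: "\<mu> = f (l k)" by (auto simp: spec_T spec_M)
    have lk: "l k \<in> spectrum ?M" using k by (simp add: spec_M)
    (* An eigenvalue in the open disc is not 1, so the denominator in the bound on \<omega> is positive. *)
    from disc[OF lk] have "l k \<noteq> 1" by auto
    moreover have dist: "(cmod (1 - l k))\<^sup>2 = (1 - a k)\<^sup>2 + (b k)\<^sup>2"
      unfolding cmod_power2 using Re_l[OF k] Im_l[OF k] by simp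
    ultimately have "0 < (1 - a k)\<^sup>2 + (b k)\<^sup>2"
      by (metis right_minus_eq zero_less_norm_iff zero_less_power)
    moreover from ii k
    have "\<omega> < (4 * (a k)\<^sup>2 - 4 * a k + 4 * (b k)\<^sup>2) / ((1 - a k)\<^sup>2 + (b k)\<^sup>2)"
      by blast
    ultimately have "\<omega> * ((1 - a k)\<^sup>2 + (b k)\<^sup>2) < 4 * (a k)\<^sup>2 - 4 * a k + 4 * (b k)\<^sup>2"
      by (simp add: pos_less_divide_eq)
    then have "\<omega> / 2 * (cmod (1 - l k))\<^sup>2 < 2 * ((cmod (l k))\<^sup>2 - Re (l k))"
      unfolding dist cmod_power2[of "l k"] Re_l[OF k] Im_l[OF k] by simp
    with ii k have "cmod (f (l k)) < cmod (l k)"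
      unfolding f_def by (intro norm_relaxed_less) auto
    also have "\<dots> \<le> spectral_radius ?M" by (rule norm_le_spectral_radius[OF M n lk])
    finally show "spectral_radius ?T < spectral_radius ?M" by (simp add: \<mu> \<mu>_eq)
  next
    obtain \<nu> where "\<nu> \<in> spectrum ?M" "spectral_radius ?M = cmod \<nu>"
      using spectral_radius_attained[OF M n] .
    then show "spectral_radius ?M < 1" using disc by simp
  qed
  ultimately show ?thesis by blast
qed

end
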